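(* Let $V=\mathbb{R}^m$ and let $\|\cdot\|:V\to\mathbb{R}$ be a convex functional. Let $L:V\to V$ be a linear operator such that $$\|e^{\tau L}u\|\le \|u\|\qquad\text{for all } u\in V \text{ and all } \tau\ge 0,$$ and let $N:V\to V$ be a (possibly nonlinear) operator such that, for some $\Delta t_{\mathrm{FE}}>0$, $$\|u+\Delta t\,N(u)\|\le\|u\|\qquad\text{for all } u\in V \text{ and all } 0\le \Delta t\le \Delta t_{\mathrm{FE}}.$$ Consider an explicit SSP two-step Runge--Kutta method with $s$ stages, SSP coefficient $\mathcal{C}=r>0$, coefficients $v_{i,1},v_{i,2},\hat\alpha_i,\alpha_{i,j}$ ($2\le i\le s+1$, $1\le j\le i-1$) and abscissas $c_1,\dots,c_{s+1}$, as defined in the context, and suppose that its abscissas are non-decreasing: $$0=c_1\le c_2\le c_3\le\dots\le c_s\le c_{s+1}=1 .$$ Given $u^{n-1},u^n\in V$ and $\Delta t\ge 0$, let $u^{n+1}$ be defined by the corresponding integrating factor two-step Runge--Kutta method $$ \begin{aligned} y_1&=u^n,\\ y_i&=v_{i,1}\,e^{(c_i+1)\Delta t L}u^{n-1}+v_{i,2}\,e^{c_i\Delta t L}u^{n}+\hat\alpha_i\, e^{(c_i+1)\Delta t L}\Big(u^{n-1}+\tfrac{\Delta t}{r}N(u^{n-1})\Big)\\ &\qquad+\sum_{j=1}^{i-1}\alpha_{i,j}\,e^{(c_i-c_j)\Delta t L}\Big(y_j+\tfrac{\Delta t}{r}N(y_j)\Big),\qquad 2\le i\le s+1,\\ u^{n+1}&=y_{s+1}.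 \end{aligned} $$ Then $$\|u^{n+1}\|\le\max\{\|u^{n-1}\|,\|u^n\|\}\qquad\text{for all } \Delta t\le \mathcal{C}\,\Delta t_{\mathrm{FE}},\quad\text{where }\mathcal{C}=r.$$
   Context: An explicit SSP two-step Runge--Kutta method with $s$ stages and SSP coefficient $r>0$ for an ODE $u_t=F(u)$ is a method that can be written as $$ \begin{aligned} y_1&=u^n,\\ y_i&=v_{i,1}u^{n-1}+v_{i,2}u^n+\hat\alpha_i\Big(u^{n-1}+\tfrac{\Delta t}{r}F(u^{n-1})\Big)+\sum_{j=1}^{i-1}\alpha_{i,j}\Big(y_j+\tfrac{\Delta t}{r}F(y_j)\Big),\quad 2\le i\le s+1,\\ u^{n+1}&=y_{s+1}, \end{aligned} $$ where all coefficients are real with $0\le v_{i,1},v_{i,2}\le 1$, $\hat\alpha_i\ge0$, $\alpha_{i,j}\ge 0$, and the consistency condition $v_{i,1}+v_{i,2}+\hat\alpha_i+\sum_{j=1}^{i-1}\alpha_{i,j}=1$ holds for each $i$. The abscissas $c_1,\dots,c_{s+1}$ are the time levels of the stages in units of $\Delta t$, measured from the time level of $u^n$ (so $u^{n-1}$ sits at level $-1$): $c_1=0$ and, for $2\le i\le s+1$, $c_i=-v_{i,1}+\hat\alpha_i\big(-1+\tfrac1r\big)+\sum_{j=1}^{i-1}\alpha_{i,j}\big(c_j+\tfrac1r\big)$; consistency of the method gives $c_{s+1}=1$. The integrating factor method is obtained by applying this method to the transformed problem $w_t=e^{-Lt}N(e^{Lt}w)$, $w=e^{-Lt}u$, arising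 from $u_t=Lu+N(u)$. Here $e^{\tau L}$ is the matrix (operator) exponential, $\Delta t$ is a non-negative time step, and "convex functional" means $\|\lambda u+(1-\lambda)v\|\le\lambda\|u\|+(1-\lambda)\|v\|$ for $\lambda\in[0,1]$ (it need not be a norm). *)

theory Defs
  imports "HOL-Analysis.Analysis"
begin

text \<open>The exponential \<open>e\<^sup>A\<close> of a linear operator, as its power series evaluated at a vector.
  On a finite-dimensional space the series converges everywhere, see \<open>summable_op_exp\<close> below.\<close>

definition op_exp :: "('a::real_normed_vector \<Rightarrow> 'a) \<Rightarrow> 'a \<Rightarrow> 'a" where
  "op_exp A u = (\<Sum>n. (1 / fact n) *\<^sub>R (A ^^ n) u)"

lemma summable_op_exp:
  fixes A :: "'a::euclidean_space \<Rightarrow> 'a"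
  assumes "linear A"
  shows "summable (\<lambda>n. (1 / fact n) *\<^sub>R (A ^^ n) u)"
proof -
  obtain B where B: "B > 0" "\<And>x. norm (A x) \<le> B * norm x"
    using linear_bounded_pos[OF assms] by blast
  have *: "norm ((A ^^ n) u) \<le> B ^ n * norm u" for n
  proof (induction n)
    case (Suc n)
    have "norm ((A ^^ Suc n) u) \<le> B * norm ((A ^^ n) u)"
      using B(2) by simp
    also have "\<dots> \<le> B * (B ^ n * norm u)"
      using Suc B(1) by (intro mult_left_mono) auto
    finally show ?case by (simp add: mult_ac)
  qed simp
  have "summable (\<lambda>n. inverse (fact n) * B ^ n * norm u)"
    by (intro summable_mult2 summable_exp)
  then show ?thesis
    by (rule summable_comparison_test'[where N = 0])
      (use * in \<open>auto simp: divide_simps mult_ac\<close>)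
qed

abbreviation exp_flow :: "real \<Rightarrow> ('a::real_normed_vector \<Rightarrow> 'a) \<Rightarrow> 'a \<Rightarrow> 'a" where
  "exp_flow \<tau> L \<equiv> op_exp (\<lambda>v. \<tau> *\<^sub>R L v)"

text \<open>The data of a two-step Runge--Kutta method in Shu--Osher form.  With \<open>s\<close> stages, the
  coefficients are meaningful for \<open>i \<in> {2..s+1}\<close> and \<open>j \<in> {1..<i}\<close> only; other values are
  never used.  The fields \<open>v1\<close>, \<open>v2\<close>, \<open>ahat\<close>, \<open>alpha\<close> are \<open>v\<^sub>i\<^sub>,\<^sub>1\<close>, \<open>v\<^sub>i\<^sub>,\<^sub>2\<close> and the weights of the
  forward Euler steps of length \<open>\<Delta>t / r\<close> from \<open>u\<^sup>n\<^sup>-\<^sup>1\<close> and from \<open>y\<^sub>j\<close>, with \<open>r\<close> the SSP coefficient.\<close>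

record tsrk =
  stages :: nat
  ssp_coeff :: real
  v1 :: "nat \<Rightarrow> real"
  v2 :: "nat \<Rightarrow> real"
  ahat :: "nat \<Rightarrow> real"
  alpha :: "nat \<Rightarrow> nat \<Rightarrow> real"

definition ssp_tsrk :: "tsrk \<Rightarrow> bool" where
  "ssp_tsrk M \<longleftrightarrow>
     stages M \<ge> 1 \<and> ssp_coeff M > 0 \<and>
     (\<forall>i\<in>{2..stages M + 1}.
        0 \<le> v1 M i \<and> v1 M i \<le> 1 \<and> 0 \<le> v2 M i \<and> v2 M i \<le> 1 \<and> 0 \<le> ahat M i \<and>
        (\<forall>j\<in>{1..<i}. 0 \<le> alpha M i j) \<and>
        v1 M i + v2 M i + ahat M i + (\<Sum>j\<in>{1..<i}. alpha M i j) = 1)"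

text \<open>Time levels of the stages in units of \<open>\<Delta>t\<close>, relative to the time level of \<open>u\<^sup>n\<close>.\<close>

fun abscissa :: "tsrk \<Rightarrow> nat \<Rightarrow> real" where
  "abscissa M i =
     (if i \<le> 1 then 0
      else - v1 M i + ahat M i * (- 1 + 1 / ssp_coeff M)
           + (\<Sum>j\<in>{1..<i}. alpha M i j * (abscissa M j + 1 / ssp_coeff M)))"

declare abscissa.simps [simp del]

text \<open>The stages of the integrating factor method for \<open>u\<^sub>t = L u + N(u)\<close>, with \<open>up\<close> standing for
  \<open>u\<^sup>n\<^sup>-\<^sup>1\<close> and \<open>u\<close> for \<open>u\<^sup>n\<close>.\<close>

fun if_stage ::
  "tsrk \<Rightarrow> ('a::real_normed_vector \<Rightarrow> 'a) \<Rightarrow> ('a \<Rightarrow> 'a) \<Rightarrow> real \<Rightarrow> 'a \<Rightarrow> 'a \<Rightarrow> nat \<Rightarrow> 'a" where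
  "if_stage M L N dt up u i =
     (if i \<le> 1 then u
      else v1 M i *\<^sub>R exp_flow ((abscissa M i + 1) * dt) L up
           + v2 M i *\<^sub>R exp_flow (abscissa M i * dt) L u
           + ahat M i *\<^sub>R exp_flow ((abscissa M i + 1) * dt) L (up + (dt / ssp_coeff M) *\<^sub>R N up)
           + (\<Sum>j\<in>{1..<i}. alpha M i j *\<^sub>R
                exp_flow ((abscissa M i - abscissa M j) * dt) L
                  (if_stage M L N dt up u j
                   + (dt / ssp_coeff M) *\<^sub>R N (if_stage M L N dt up u j))))"

declare if_stage.simps [simp del]

definition if_step ::
  "tsrk \<Rightarrow> ('a::real_normed_vector \<Rightarrow> 'a) \<Rightarrow> ('a \<Rightarrow> 'a) \<Rightarrow> real \<Rightarrow> 'a \<Rightarrow> 'a \<Rightarrow> 'a" where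
  "if_step M L N dt up u = if_stage M L N dt up u (stages M + 1)"

end

theory Submission imports Defs begin

text \<open>Every stage is a convex combination of images of \<open>u\<^sup>n\<^sup>-\<^sup>1\<close>, \<open>u\<^sup>n\<close> and earlier stages under
  maps that do not increase \<open>\<Phi>\<close>: forward Euler steps of length at most \<open>\<Delta>t\<^sub>F\<^sub>E\<close>, followed by flows of
  \<open>L\<close> over times that are nonnegative because the abscissas are non-decreasing.  Hence no stage
  leaves the convex sublevel set \<open>{x. \<Phi> x \<le> max (\<Phi> u\<^sup>n\<^sup>-\<^sup>1) (\<Phi> u\<^sup>n)}\<close>.\<close>

text \<open>Shaped like the recursion in \<open>if_stage\<close>, so that membership of a stage
  reduces to membership of its summands. Absorbing the three single terms into the sum lets
  \<open>convex_sum\<close> apply.\<close>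

lemma convex_combination_three_plus_sum:
  fixes x y z :: "'a::real_vector" and g :: "nat \<Rightarrow> 'a"
  assumes "convex S" and "x \<in> S" "y \<in> S" "z \<in> S" and "\<And>j. j \<in> {m..<n} \<Longrightarrow> g j \<in> S"
    and "0 \<le> a" "0 \<le> b" "0 \<le> c" and "\<And>j. j \<in> {m..<n} \<Longrightarrow> 0 \<le> w j"
    and "a + b + c + (\<Sum>j\<in>{m..<n}. w j) = 1" and "m \<le> n"
  shows "a *\<^sub>R x + b *\<^sub>R y + c *\<^sub>R z + (\<Sum>j\<in>{m..<n}. w j *\<^sub>R g j) \<in> S"
proof -
  \<comment> \<open>The single terms take the three indices just past \<open>{m..<n}\<close>, where
    overwriting leaves the original sum unchanged.\<close>
  define w' where "w' = w(n := a, Suc n := b, Suc (Suc n) := c)"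
  define g' where "g' = g(n := x, Suc n := y, Suc (Suc n) := z)"
  let ?I = "{m..<Suc (Suc (Suc n))}"
  have eq: "(\<Sum>j\<in>{m..<n}. w' j) = (\<Sum>j\<in>{m..<n}. w j)"
    "(\<Sum>j\<in>{m..<n}. w' j *\<^sub>R g' j) = (\<Sum>j\<in>{m..<n}. w j *\<^sub>R g j)"
    by (auto intro!: sum.cong simp: w'_def g'_def)
  have top: "w' n = a" "w' (Suc n) = b" "w' (Suc (Suc n)) = c"
    "g' n = x" "g' (Suc n) = y" "g' (Suc (Suc n)) = z"
    by (simp_all add: w'_def g'_def)
  have "(\<Sum>j\<in>?I. w' j *\<^sub>R g' j) \<in> S"
  proof (rule convex_sum)
    show "(\<Sum>j\<in>?I. w' j) = 1"
      using assms(10,11) by (simp add: eq top algebra_simps)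
    show "0 \<le> w' j" if "j \<in> ?I" for j
      using that assms(6-9) by (auto simp: w'_def)
    show "g' j \<in> S" if "j \<in> ?I" for j
      using that assms(2-5) by (auto simp: g'_def)
  qed (use assms(1) in auto)
  then show ?thesis
    using assms(11) by (simp add: eq top algebra_simps)
qed

theorem theorem4p2:
  fixes \<Phi> :: "real ^ 'm \<Rightarrow> real"
    and L N :: "real ^ 'm \<Rightarrow> real ^ 'm"
    and dtFE dt :: real
    and M :: tsrk
    and u_prev u_cur :: "real ^ 'm"
  assumes "convex_on UNIV \<Phi>"
    and "linear L"
    and "\<And>u \<tau>. 0 \<le> \<tau> \<Longrightarrow> \<Phi> (exp_flow \<tau> L u) \<le> \<Phi> u"
    and "0 < dtFE"
    and "\<And>u h. 0 \<le> h \<Longrightarrow> h \<le> dtFE \<Longrightarrow> \<Phi> (u + h *\<^sub>R N u) \<le> \<Phi> u"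
    and "ssp_tsrk M"
    and "abscissa M 1 = 0"
    and "\<And>i. i \<in> {1..stages M} \<Longrightarrow> abscissa M i \<le> abscissa M (i + 1)"
    and "abscissa M (stages M + 1) = 1"
    and "0 \<le> dt"
    and "dt \<le> ssp_coeff M * dtFE"
  shows "\<Phi> (if_step M L N dt u_prev u_cur) \<le> max (\<Phi> u_prev) (\<Phi> u_cur)"
proof -
  define S where "S = {x. \<Phi> x \<le> max (\<Phi> u_prev) (\<Phi> u_cur)}"
  have S: "convex S"
  proof (rule convexI)
    fix x y and a b :: real
    assume xy: "x \<in> S" "y \<in> S" and ab: "0 \<le> a" "0 \<le> b" "a + b = 1"
    have "\<Phi> (a *\<^sub>R x + b *\<^sub>R y) \<le> a * \<Phi> x + b * \<Phi> y"
      using assms(1) ab by (simp add: convex_on_def)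
    also have "\<dots> \<le> max (\<Phi> u_prev) (\<Phi> u_cur)"
      using xy ab by (intro convex_bound_le) (auto simp: S_def)
    finally show "a *\<^sub>R x + b *\<^sub>R y \<in> S"
      by (simp add: S_def)
  qed
  have r: "0 < ssp_coeff M"
    using assms(6) by (simp add: ssp_tsrk_def)
  have mono: "abscissa M j \<le> abscissa M i" if "1 \<le> j" "j \<le> i" "i \<le> stages M + 1" for i j
    \<comment> \<open>\<open>j \<le> i\<close> comes first because \<open>dec_induct\<close>
      consumes it; the bound on \<open>i\<close> stays in the induction statement.\<close>
    using that(2,3,1)
  proof (induction i rule: dec_induct)
    case (step i)
    then show ?case using assms(8)[of i] by force
  qed simp
  have flow: "exp_flow \<tau> L x \<in> S" if "x \<in> S" "0 \<le> \<tau>" for \<tau> x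
    using assms(3)[OF that(2), of x] that(1) by (simp add: S_def)
  \<comment> \<open>The time step restriction enters here: it says that
    \<open>dt / ssp_coeff M\<close> is at most \<open>dtFE\<close>.\<close>
  have euler: "x + (dt / ssp_coeff M) *\<^sub>R N x \<in> S" if "x \<in> S" for x
    using assms(5)[of "dt / ssp_coeff M" x] assms(10,11) r that
    by (simp add: S_def divide_simps mult.commute)
  have init: "u_prev \<in> S" "u_cur \<in> S"
    by (simp_all add: S_def)
  have "if_stage M L N dt u_prev u_cur i \<in> S" if "i \<le> stages M + 1" for i
    using that
  proof (induction i rule: less_induct)
    case (less i)
    show ?case
    proof (cases "i \<le> 1")
      case True
      then show ?thesis by (subst if_stage.simps) (simp add: init)
    next
      case False
      \<comment> \<open>This makes both flow times from the old values,
        \<open>abscissa M i * dt\<close> and \<open>(abscissa M i + 1) * dt\<close>,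
        nonnegative.\<close>
      have c: "0 \<le> abscissa M i"
        using mono[of 1 i] assms(7) False less.prems by simp
      have M: "0 \<le> v1 M i" "0 \<le> v2 M i" "0 \<le> ahat M i" "\<And>j. j \<in> {1..<i} \<Longrightarrow> 0 \<le> alpha M i j"
        "v1 M i + v2 M i + ahat M i + (\<Sum>j\<in>{1..<i}. alpha M i j) = 1"
        using assms(6) False less.prems by (auto simp: ssp_tsrk_def)
      \<comment> \<open>The induction hypothesis puts stage \<open>j\<close> in \<open>S\<close>,
        and \<open>mono\<close> makes the flow time nonnegative.\<close>
      have earlier: "exp_flow ((abscissa M i - abscissa M j) * dt) L
          (if_stage M L N dt u_prev u_cur j
            + (dt / ssp_coeff M) *\<^sub>R N (if_stage M L N dt u_prev u_cur j)) \<in> S"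
        if "j \<in> {1..<i}" for j
        using that less mono[of j i] assms(10) by (intro flow euler) auto
      show ?thesis
        unfolding if_stage.simps[of M L N dt u_prev u_cur i] if_not_P[OF False]
      proof (rule convex_combination_three_plus_sum[OF S _ _ _ earlier M(1-5)])
        show "1 \<le> i"
          using False by simp
      qed (use c assms(10) in \<open>auto intro!: flow euler init\<close>)
    qed
  qed
  from this[of "stages M + 1"] show ?thesis
    by (simp add: if_step_def S_def)
qed

end
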